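(* Let $a,b\in\mathbb{C}$ and put $y=\dfrac{2z^3-b}{3(z^2-a)}$. Then, as an identity of indefinite integrals (up to an additive constant, with corresponding choices of branches of the square roots), $$\int\frac{(2z^2-a)\,dz}{\sqrt{(z^2-a)(8z^3-6az-b)}}-\frac13\sqrt{\frac{8z^3-6az-b}{z^2-a}}=\frac{1}{2\sqrt3}\int\frac{y\,dy}{\sqrt{y^3-3ay+b}}.$$
   Context: The identity is understood locally in $z$, on a simply connected domain avoiding the zeros of $z^2-a$, $8z^3-6az-b$ and $y^3-3ay+b$: for a given branch of $\sqrt{(z^2-a)(8z^3-6az-b)}$, the square root $\sqrt{(8z^3-6az-b)/(z^2-a)}$ means $\sqrt{(z^2-a)(8z^3-6az-b)}/(z^2-a)$, and the branch of $\sqrt{y^3-3ay+b}$ is the suitable one of its two branches. The right-hand integral is taken along the image under $z\mapsto y$. *)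

theory Defs
  imports "HOL-Complex_Analysis.Complex_Analysis"
begin

definition sqrt_branch_on :: "complex set \<Rightarrow> (complex \<Rightarrow> complex) \<Rightarrow> (complex \<Rightarrow> complex) \<Rightarrow> bool" where
  "sqrt_branch_on D f s \<longleftrightarrow> continuous_on D s \<and> (\<forall>z\<in>D. (s z)\<^sup>2 = f z)"

definition primitive_on :: "complex set \<Rightarrow> (complex \<Rightarrow> complex) \<Rightarrow> (complex \<Rightarrow> complex) \<Rightarrow> bool" where
  "primitive_on D f F \<longleftrightarrow> (\<forall>z\<in>D. (F has_field_derivative f z) (at z))"

text \<open>
  \<open>image_primitive_on D y g h w G\<close>: as a function of \<open>z\<close>, \<open>G\<close> is the indefinite integral of
  \<open>g(y) dy / sqrt (h(y))\<close> along the map \<open>z \<mapsto> y\<close>, where \<open>w z\<close> is the value of the square root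
  used at the point \<open>y z\<close>.  The integration is in the variable \<open>y\<close>: near every point of \<open>D\<close>, \<open>G\<close> is a
  primitive \<open>H\<close> with respect to \<open>y\<close>, evaluated at \<open>y z\<close>.  This is required only locally because \<open>y\<close> need
  not be injective on \<open>D\<close>, so that in general \<open>w\<close> and \<open>G\<close> are not functions of \<open>y\<close> on all of \<open>y ` D\<close>.
\<close>

definition image_primitive_on ::
  "complex set \<Rightarrow> (complex \<Rightarrow> complex) \<Rightarrow> (complex \<Rightarrow> complex) \<Rightarrow> (complex \<Rightarrow> complex) \<Rightarrow>
    (complex \<Rightarrow> complex) \<Rightarrow> (complex \<Rightarrow> complex) \<Rightarrow> bool" where
  "image_primitive_on D y g h w G \<longleftrightarrow>
    (\<forall>z\<in>D. \<exists>U V r H. open U \<and> z \<in> U \<and> U \<subseteq> D \<and> open V \<and> y ` U \<subseteq> V \<and>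
       sqrt_branch_on V h r \<and> primitive_on V (\<lambda>v. g v / r v) H \<and>
       (\<forall>x\<in>U. w x = r (y x) \<and> G x = H (y x)))"

end

theory Submission imports Defs begin

text \<open>
  Write \<open>q = z\<^sup>2 - a\<close>, \<open>p = 8 z\<^sup>3 - 6 a z - b\<close> and \<open>Q = z\<^sup>3 - 3 a z + b\<close>.  For generic
  \<open>a\<close> and \<open>b\<close> the substitution is a transformation of degree three between elliptic curves, and
  everything rests on the two identities
  \<open>27 q\<^sup>3 (y\<^sup>3 - 3 a y + b) = p Q\<^sup>2\<close> and \<open>3 q\<^sup>2 y' = 2 z Q\<close>, which share the factor \<open>Q\<close>.
  The first says that \<open>w = s Q / (3 \<surd>3 q\<^sup>2)\<close> is a branch of the square root of \<open>y\<^sup>3 - 3 a y + b\<close>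
  whenever \<open>s\<^sup>2 = p q\<close>; this choice of sign is the suitable one.  In \<open>y y' / w\<close> the factor \<open>Q\<close>
  cancels, and what remains is \<open>2 \<surd>3\<close> times
  \<open>z (2 z\<^sup>3 - b) / (3 q s)\<close>, which is also the derivative of the left-hand side of the identity.  On
  the connected domain the two sides therefore differ by a constant.

  The analytic part is independent of these formulas.  A continuous square root of a nonvanishing
  differentiable function is differentiable (\<open>sqrt_branch_on_has_field_derivative\<close>), so the
  integrands are holomorphic and have primitives on a simply connected domain.  An indefinite
  integral along \<open>y\<close> has the derivative that the chain rule predicts
  (\<open>image_primitive_on_has_field_derivative\<close>), and conversely a primitive of that derivative is
  locally a function of \<open>y\<close> (\<open>image_primitive_on_exists\<close>).
\<close>

section \<open>Branches of square roots\<close>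

text \<open>
  The difference quotient of \<open>s\<close> at \<open>z\<close> is that of \<open>s\<^sup>2 = f\<close> divided by \<open>s x + s z\<close>, which by
  continuity stays away from zero near \<open>z\<close>.
\<close>

lemma sqrt_branch_on_has_field_derivative:
  assumes "open D" "sqrt_branch_on D f s" "z \<in> D" "f z \<noteq> 0"
    and f: "(f has_field_derivative f') (at z)"
  shows "(s has_field_derivative f' / (2 * s z)) (at z)"
proof -
  have sq: "(s x)\<^sup>2 = f x" if "x \<in> D" for x
    using assms that by (auto simp: sqrt_branch_on_def)
  have "isCont s z"
    using assms by (auto simp: sqrt_branch_on_def continuous_on_eq_continuous_at)
  then have lim: "((\<lambda>x. s x + s z) \<longlongrightarrow> 2 * s z) (at z)"
    using tendsto_add[of s "s z" "at z" "\<lambda>x. s z" "s z"] by (auto simp: isCont_def)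
  have "s z \<noteq> 0"
    using sq[of z] assms by auto
  then have ne: "\<forall>\<^sub>F x in at z. s x + s z \<noteq> 0"
    using tendsto_imp_eventually_ne[OF lim] by simp
  have inD: "\<forall>\<^sub>F x in at z. x \<in> D"
    using assms eventually_at_in_open'[of D z] by simp
  have "((\<lambda>x. (f x - f z) / (x - z) / (s x + s z)) \<longlongrightarrow> f' / (2 * s z)) (at z)"
    using f lim \<open>s z \<noteq> 0\<close> by (intro tendsto_divide) (auto simp: has_field_derivative_iff)
  moreover have "\<forall>\<^sub>F x in at z. (f x - f z) / (x - z) / (s x + s z) = (s x - s z) / (x - z)"
    using ne inD
  proof eventually_elim
    case (elim x)
    have "f x - f z = (s x - s z) * (s x + s z)"
      using sq[of x] sq[of z] elim assms by (simp add: power2_eq_square algebra_simps)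
    then show ?case
      using elim by simp
  qed
  ultimately show ?thesis
    unfolding has_field_derivative_iff by (rule Lim_transform_eventually)
qed

lemma sqrt_branch_on_holomorphic:
  assumes "open D" "sqrt_branch_on D f s" "f holomorphic_on D" "\<And>z. z \<in> D \<Longrightarrow> f z \<noteq> 0"
  shows "s holomorphic_on D"
proof -
  have "(s has_field_derivative deriv f z / (2 * s z)) (at z)" if "z \<in> D" for z
    using assms that
    by (intro sqrt_branch_on_has_field_derivative[of D f] holomorphic_derivI[of f D]) auto
  then show ?thesis
    using assms(1) by (auto simp: holomorphic_on_open)
qed

lemma sqrt_branch_on_minus:
  "sqrt_branch_on D f s \<Longrightarrow> sqrt_branch_on D f (\<lambda>z. - s z)"
  by (auto simp: sqrt_branch_on_def intro: continuous_intros)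

lemma sqrt_branch_on_unique:
  assumes "connected D" "sqrt_branch_on D f r" "sqrt_branch_on D f s"
    and nz: "\<And>z. z \<in> D \<Longrightarrow> f z \<noteq> 0"
  shows "(\<forall>z\<in>D. s z = r z) \<or> (\<forall>z\<in>D. s z = - r z)"
proof -
  have r: "(r z)\<^sup>2 = f z" and s: "(s z)\<^sup>2 = f z" if "z \<in> D" for z
    using assms that by (auto simp: sqrt_branch_on_def)
  have r0: "r z \<noteq> 0" if "z \<in> D" for z
    using r nz that by fastforce
  have pm: "s z / r z \<in> {1, -1}" if "z \<in> D" for z
  proof -
    have "s z = r z \<or> s z = - r z"
      using r[OF that] s[OF that] by (metis power2_eq_iff)
    then show ?thesis
      using r0[OF that] by auto
  qed
  have "(\<lambda>z. s z / r z) constant_on D"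
  proof (rule continuous_finite_range_constant[OF \<open>connected D\<close>])
    show "continuous_on D (\<lambda>z. s z / r z)"
      using assms(2,3) r0 by (auto simp: sqrt_branch_on_def intro: continuous_intros)
    have "(\<lambda>z. s z / r z) ` D \<subseteq> {1, -1}"
      using pm by (rule image_subsetI)
    then show "finite ((\<lambda>z. s z / r z) ` D)"
      by (rule finite_subset) simp
  qed
  then obtain c where c: "s z / r z = c" if "z \<in> D" for z
    by (auto simp: constant_on_def)
  show ?thesis
  proof (cases "D = {}")
    case False
    then obtain z0 where "z0 \<in> D"
      by blast
    then have "c = 1 \<or> c = -1"
      using pm[of z0] c[of z0] by simp
    moreover have "s z = c * r z" if "z \<in> D" for z
      using c[OF that] r0[OF that] by (simp add: field_simps)
    ultimately show ?thesis
      by auto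
  qed auto
qed

section \<open>Primitives\<close>

lemma primitive_on_exists:
  assumes "open D" "simply_connected D" "f holomorphic_on D"
  shows "\<exists>F. primitive_on D f F"
  using assms simply_connected_eq_global_primitive[of D] unfolding primitive_on_def by blast

lemma primitive_on_unique:
  assumes "open D" "connected D" "primitive_on D f F" "primitive_on D f G"
  shows "\<exists>c. \<forall>z\<in>D. F z = G z + c"
proof -
  have "((\<lambda>z. F z - G z) has_field_derivative 0) (at z)" if "z \<in> D" for z
    using assms(3,4) that DERIV_diff[of F "f z" z UNIV G "f z"] by (auto simp: primitive_on_def)
  then have "(\<lambda>z. F z - G z) constant_on D"
    using assms has_field_derivative_0_imp_constant_on by blast
  then obtain c where "F z - G z = c" if "z \<in> D" for z
    by (auto simp: constant_on_def)
  then show ?thesis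
    by (intro exI[of _ c]) (auto simp: algebra_simps)
qed

lemma image_primitive_on_has_field_derivative:
  assumes "image_primitive_on D y g h w G" "z \<in> D"
    and y: "(y has_field_derivative y') (at z)"
  shows "(G has_field_derivative g (y z) / w z * y') (at z)"
proof -
  obtain U V r H where U: "open U" "z \<in> U" and "y ` U \<subseteq> V"
    and H: "primitive_on V (\<lambda>v. g v / r v) H"
    and eq: "\<And>x. x \<in> U \<Longrightarrow> w x = r (y x) \<and> G x = H (y x)"
    using assms unfolding image_primitive_on_def by meson
  have "(H has_field_derivative g (y z) / w z) (at (y z))"
    using H U eq[of z] \<open>y ` U \<subseteq> V\<close> by (auto simp: primitive_on_def)
  from DERIV_chain2[OF this y] show ?thesis
    by (rule has_field_derivative_transform_within_open[OF _ U]) (simp add: eq)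
qed

text \<open>
  Take a primitive \<open>G\<close> of \<open>g (y z) y' / w\<close> on \<open>D\<close>.  Over a disc around \<open>y z\<close> on which \<open>h\<close> has no
  zero there is a holomorphic branch of the square root of \<open>h\<close>; near \<open>z\<close> its pullback is \<open>\<plusminus> w\<close>, so up to
  sign it is the required local branch.  A primitive on the disc, pulled back, differs from \<open>G\<close>
  near \<open>z\<close> by a constant, which can be absorbed.
\<close>

lemma image_primitive_on_exists:
  assumes D: "open D" "simply_connected D"
    and y: "y holomorphic_on D" and g: "g holomorphic_on UNIV" and h: "h holomorphic_on UNIV"
    and w: "sqrt_branch_on D (\<lambda>z. h (y z)) w"
    and nz: "\<And>z. z \<in> D \<Longrightarrow> h (y z) \<noteq> 0"
  shows "\<exists>G. image_primitive_on D y g h w G"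
proof -
  have y': "(y has_field_derivative deriv y z) (at z)" if "z \<in> D" for z
    using y D(1) that by (rule holomorphic_derivI)
  have contU: "continuous_on U y" if "U \<subseteq> D" for U
    using y that continuous_on_subset holomorphic_on_imp_continuous_on by blast
  have w0: "w z \<noteq> 0" if "z \<in> D" for z
    using w nz[OF that] that by (auto simp: sqrt_branch_on_def)
  have gy: "(\<lambda>z. g (y z)) holomorphic_on D" and hy: "(\<lambda>z. h (y z)) holomorphic_on D"
    using holomorphic_on_compose_gen[OF y g] holomorphic_on_compose_gen[OF y h]
    by (auto simp: o_def)
  have "w holomorphic_on D"
    using sqrt_branch_on_holomorphic[OF D(1) w hy nz] .
  then have "(\<lambda>z. g (y z) / w z * deriv y z) holomorphic_on D"
    using gy y D(1) w0 by (intro holomorphic_intros holomorphic_deriv) auto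
  from primitive_on_exists[OF D this] obtain G
    where G: "primitive_on D (\<lambda>z. g (y z) / w z * deriv y z) G" ..
  have "\<exists>U V r H. open U \<and> z \<in> U \<and> U \<subseteq> D \<and> open V \<and> y ` U \<subseteq> V \<and>
       sqrt_branch_on V h r \<and> primitive_on V (\<lambda>v. g v / r v) H \<and>
       (\<forall>x\<in>U. w x = r (y x) \<and> G x = H (y x))" if z: "z \<in> D" for z
  proof -
    have "open (h -` (- {0}))"
      using h by (intro open_vimage) (auto simp: holomorphic_on_imp_continuous_on)
    then obtain e where e: "e > 0" "ball (y z) e \<subseteq> h -` (- {0})"
      using nz[OF z] by (metis ComplI openE singletonD vimageI2)
    define V where "V = ball (y z) e"
    have V: "open V" "simply_connected V" "y z \<in> V" "\<And>v. v \<in> V \<Longrightarrow> h v \<noteq> 0"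
      using e by (auto simp: V_def convex_imp_simply_connected)
    have hV: "h holomorphic_on V" and gV: "g holomorphic_on V"
      using h g by (auto intro: holomorphic_on_subset)
    obtain r0 where r0: "sqrt_branch_on V h r0"
      using simply_connected_eq_holomorphic_sqrt[OF V(1)] V(2,4) hV
      unfolding sqrt_branch_on_def by (metis holomorphic_on_imp_continuous_on)
    have "open (D \<inter> y -` V)"
      using contU[of D] D(1) V(1) by (intro continuous_open_preimage) auto
    then obtain d where d: "d > 0" "ball z d \<subseteq> D \<inter> y -` V"
      using z V(3) by (metis IntI openE vimageI)
    define U where "U = ball z d"
    have U: "open U" "connected U" "z \<in> U" "U \<subseteq> D" "y ` U \<subseteq> V"
      using d by (auto simp: U_def)
    have pull: "sqrt_branch_on U (\<lambda>x. h (y x)) (\<lambda>x. r (y x))" if "sqrt_branch_on V h r" for r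
      using that U contU[OF U(4)]
      by (auto simp: sqrt_branch_on_def intro: continuous_on_compose2)
    have "sqrt_branch_on U (\<lambda>x. h (y x)) w"
      using w U(4) by (auto simp: sqrt_branch_on_def intro: continuous_on_subset)
    then have "(\<forall>x\<in>U. w x = r0 (y x)) \<or> (\<forall>x\<in>U. w x = - r0 (y x))"
      using sqrt_branch_on_unique[OF U(2) pull[OF r0]] nz U(4) by auto
    then obtain r where r: "sqrt_branch_on V h r" and wr: "\<forall>x\<in>U. w x = r (y x)"
      using r0 sqrt_branch_on_minus by blast
    have "r holomorphic_on V"
      using sqrt_branch_on_holomorphic[OF V(1) r hV V(4)] .
    moreover have "r v \<noteq> 0" if "v \<in> V" for v
      using r V(4)[OF that] that by (auto simp: sqrt_branch_on_def)
    ultimately have "(\<lambda>v. g v / r v) holomorphic_on V"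
      using gV by (intro holomorphic_intros)
    from primitive_on_exists[OF V(1,2) this] obtain H
      where H: "primitive_on V (\<lambda>v. g v / r v) H" ..
    have HU: "primitive_on U (\<lambda>x. g (y x) / w x * deriv y x) (\<lambda>x. H (y x))"
      unfolding primitive_on_def
    proof
      fix x assume x: "x \<in> U"
      have "(H has_field_derivative g (y x) / w x) (at (y x))"
        using H U(5) x wr by (auto simp: primitive_on_def)
      then show "((\<lambda>x. H (y x)) has_field_derivative g (y x) / w x * deriv y x) (at x)"
        using y' U(4) x by (intro DERIV_chain2) auto
    qed
    have GU: "primitive_on U (\<lambda>x. g (y x) / w x * deriv y x) G"
      using G U(4) by (auto simp: primitive_on_def)
    obtain c where c: "\<And>x. x \<in> U \<Longrightarrow> G x = H (y x) + c"
      using primitive_on_unique[OF U(1,2) GU HU] by blast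
    have Hc: "primitive_on V (\<lambda>v. g v / r v) (\<lambda>v. H v + c)"
      using H by (auto simp: primitive_on_def intro!: derivative_eq_intros)
    have "\<forall>x\<in>U. w x = r (y x) \<and> G x = H (y x) + c"
      using wr c by blast
    with U(1,3,4,5) V(1) r Hc show ?thesis
      by blast
  qed
  then show ?thesis
    unfolding image_primitive_on_def by blast
qed

section \<open>The cubic substitution\<close>

lemma cubic_substitution_value:
  fixes a b z :: complex
  assumes "z\<^sup>2 - a \<noteq> 0" and v: "v = (2 * z ^ 3 - b) / (3 * (z\<^sup>2 - a))"
  shows "v ^ 3 - 3 * a * v + b =
    (8 * z ^ 3 - 6 * a * z - b) * (z ^ 3 - 3 * a * z + b)\<^sup>2 / (27 * (z\<^sup>2 - a) ^ 3)"
proof -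
  have e: "3 * (z\<^sup>2 - a) * v = 2 * z ^ 3 - b"
    using assms by (simp add: v)
  have "27 * (z\<^sup>2 - a) ^ 3 * (v ^ 3 - 3 * a * v + b) =
      (3 * (z\<^sup>2 - a) * v) ^ 3 - 27 * a * (z\<^sup>2 - a)\<^sup>2 * (3 * (z\<^sup>2 - a) * v) + 27 * b * (z\<^sup>2 - a) ^ 3"
    by algebra
  also have "\<dots> = (8 * z ^ 3 - 6 * a * z - b) * (z ^ 3 - 3 * a * z + b)\<^sup>2"
    unfolding e by algebra
  finally have "(v ^ 3 - 3 * a * v + b) * (27 * (z\<^sup>2 - a) ^ 3) =
      (8 * z ^ 3 - 6 * a * z - b) * (z ^ 3 - 3 * a * z + b)\<^sup>2"
    by (simp only: mult.commute)
  moreover have "27 * (z\<^sup>2 - a) ^ 3 \<noteq> 0"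
    using assms(1) by simp
  ultimately show ?thesis
    by (intro eq_divide_imp)
qed

lemma cubic_substitution_has_field_derivative:
  fixes a b z :: complex
  assumes "z\<^sup>2 - a \<noteq> 0"
  shows "((\<lambda>z. (2 * z ^ 3 - b) / (3 * (z\<^sup>2 - a))) has_field_derivative
    2 * z * (z ^ 3 - 3 * a * z + b) / (3 * (z\<^sup>2 - a)\<^sup>2)) (at z)"
proof -
  have "((\<lambda>z. (2 * z ^ 3 - b) / (3 * (z\<^sup>2 - a))) has_field_derivative
      (6 * z\<^sup>2 * (3 * (z\<^sup>2 - a)) - (2 * z ^ 3 - b) * (6 * z)) /
        (3 * (z\<^sup>2 - a) * (3 * (z\<^sup>2 - a)))) (at z)"
    using assms by (auto intro!: derivative_eq_intros)
  moreover have "(6 * z\<^sup>2 * (3 * (z\<^sup>2 - a)) - (2 * z ^ 3 - b) * (6 * z)) =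
      3 * (2 * z * (z ^ 3 - 3 * a * z + b))"
    by algebra
  moreover have "3 * (z\<^sup>2 - a) * (3 * (z\<^sup>2 - a)) = 3 * (3 * (z\<^sup>2 - a)\<^sup>2)"
    by algebra
  ultimately show ?thesis
    by (simp only: mult_divide_mult_cancel_left_if) simp
qed

text \<open>
  With \<open>s\<^sup>2 = q p\<close>, the derivative of \<open>s / q\<close> is \<open>(q p' - 2 z p) / (2 q s)\<close>, and
  \<open>q p' - 2 z p = 2 (3 q (2 z\<^sup>2 - a) - z (2 z\<^sup>3 - b))\<close>.  So the algebraic term trades the integrand
  on the left for the one that the substitution produces.
\<close>

lemma algebraic_part_has_field_derivative:
  fixes a b z :: complex
  assumes q: "z\<^sup>2 - a \<noteq> 0" and p: "8 * z ^ 3 - 6 * a * z - b \<noteq> 0" and "open D" "z \<in> D"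
    and s: "sqrt_branch_on D (\<lambda>z. (z\<^sup>2 - a) * (8 * z ^ 3 - 6 * a * z - b)) s"
  shows "((\<lambda>z. 1 / 3 * (s z / (z\<^sup>2 - a))) has_field_derivative
    (2 * z\<^sup>2 - a) / s z - z * (2 * z ^ 3 - b) / (3 * (z\<^sup>2 - a) * s z)) (at z)"
proof -
  define Q where "Q = z\<^sup>2 - a"
  define P where "P = 8 * z ^ 3 - 6 * a * z - b"
  define S where "S = s z"
  define P' where "P' = 24 * z\<^sup>2 - 6 * a"
  have nz: "Q \<noteq> 0" and S2: "S\<^sup>2 = Q * P"
    using q s \<open>z \<in> D\<close> by (auto simp: Q_def P_def S_def sqrt_branch_on_def)
  then have S0: "S \<noteq> 0"
    using p by (auto simp: P_def)
  have "((\<lambda>z. (z\<^sup>2 - a) * (8 * z ^ 3 - 6 * a * z - b)) has_field_derivative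
      2 * z * P + Q * P') (at z)"
    unfolding Q_def P_def P'_def
    by (auto intro!: derivative_eq_intros simp: algebra_simps eval_nat_numeral)
  then have "(s has_field_derivative (2 * z * P + Q * P') / (2 * S)) (at z)"
    unfolding S_def using assms
    by (intro sqrt_branch_on_has_field_derivative[OF \<open>open D\<close> s \<open>z \<in> D\<close>]) simp_all
  then have "((\<lambda>z. s z / (z\<^sup>2 - a)) has_field_derivative
      ((2 * z * P + Q * P') / (2 * S) * Q - S * (2 * z)) / (Q * Q)) (at z)"
    using nz by (auto intro!: derivative_eq_intros simp: Q_def S_def)
  from DERIV_cmult[OF this, of "1 / 3"]
  have "((\<lambda>z. 1 / 3 * (s z / (z\<^sup>2 - a))) has_field_derivative
      1 / 3 * (((2 * z * P + Q * P') / (2 * S) * Q - S * (2 * z)) / (Q * Q))) (at z)" .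
  moreover have "1 / 3 * (((2 * z * P + Q * P') / (2 * S) * Q - S * (2 * z)) / (Q * Q)) =
      (2 * z\<^sup>2 - a) / S - z * (2 * z ^ 3 - b) / (3 * Q * S)"
  proof -
    have "(2 * z * P + Q * P') / (2 * S) * Q - S * (2 * z) =
        ((2 * z * P + Q * P') * Q - 4 * z * S\<^sup>2) / (2 * S)"
      using S0 by (simp add: field_simps power2_eq_square)
    also have "\<dots> = Q * (Q * P' - 2 * z * P) / (2 * S)"
      unfolding S2 by (simp add: algebra_simps)
    finally have "1 / 3 * (((2 * z * P + Q * P') / (2 * S) * Q - S * (2 * z)) / (Q * Q)) =
        (Q * P' - 2 * z * P) / (6 * Q * S)"
      using nz S0 by simp
    also have "Q * P' - 2 * z * P = 2 * (3 * Q * (2 * z\<^sup>2 - a) - z * (2 * z ^ 3 - b))"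
      unfolding P_def Q_def P'_def by algebra
    also have "\<dots> / (6 * Q * S) = (2 * z\<^sup>2 - a) / S - z * (2 * z ^ 3 - b) / (3 * Q * S)"
      using nz S0 by (simp add: field_simps)
    finally show ?thesis .
  qed
  ultimately show ?thesis
    by (simp add: Q_def S_def)
qed

theorem mainTheorem3:
  fixes a b :: complex and D :: "complex set" and y s :: "complex \<Rightarrow> complex"
  assumes y: "y = (\<lambda>z. (2 * z ^ 3 - b) / (3 * (z\<^sup>2 - a)))"
    and D: "open D" "simply_connected D"
    and avoid: "\<And>z. z \<in> D \<Longrightarrow> z\<^sup>2 - a \<noteq> 0"
               "\<And>z. z \<in> D \<Longrightarrow> 8 * z ^ 3 - 6 * a * z - b \<noteq> 0"
               "\<And>z. z \<in> D \<Longrightarrow> y z ^ 3 - 3 * a * y z + b \<noteq> 0"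
    and s: "sqrt_branch_on D (\<lambda>z. (z\<^sup>2 - a) * (8 * z ^ 3 - 6 * a * z - b)) s"
  shows "\<exists>w. sqrt_branch_on D (\<lambda>z. y z ^ 3 - 3 * a * y z + b) w \<and>
    (\<exists>F. primitive_on D (\<lambda>z. (2 * z\<^sup>2 - a) / s z) F) \<and>
    (\<exists>G. image_primitive_on D y (\<lambda>v. v) (\<lambda>v. v ^ 3 - 3 * a * v + b) w G) \<and>
    (\<forall>F G. primitive_on D (\<lambda>z. (2 * z\<^sup>2 - a) / s z) F \<longrightarrow>
       image_primitive_on D y (\<lambda>v. v) (\<lambda>v. v ^ 3 - 3 * a * v + b) w G \<longrightarrow>
       (\<exists>C. \<forall>z\<in>D. F z - 1 / 3 * (s z / (z\<^sup>2 - a)) =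
          1 / (2 * complex_of_real (sqrt 3)) * G z + C))"
proof -
  define c :: complex where "c = complex_of_real (sqrt 3)"
  have c2: "c\<^sup>2 = 3"
    unfolding c_def by (metis of_real_numeral of_real_power real_sqrt_pow2 zero_le_numeral)
  then have c0: "c \<noteq> 0"
    by auto
  define Q where "Q = (\<lambda>z. z ^ 3 - 3 * a * z + b)"
  define w where "w = (\<lambda>z. s z * Q z / (3 * c * (z\<^sup>2 - a)\<^sup>2))"
  have s2: "(s z)\<^sup>2 = (z\<^sup>2 - a) * (8 * z ^ 3 - 6 * a * z - b)" if "z \<in> D" for z
    using s that by (auto simp: sqrt_branch_on_def)
  have s0: "s z \<noteq> 0" if "z \<in> D" for z
    using s2[OF that] avoid[OF that] by auto
  have h: "y z ^ 3 - 3 * a * y z + b =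
      (8 * z ^ 3 - 6 * a * z - b) * (Q z)\<^sup>2 / (27 * (z\<^sup>2 - a) ^ 3)" if "z \<in> D" for z
    unfolding Q_def by (rule cubic_substitution_value) (use avoid(1)[OF that] y in auto)
  have Q0: "Q z \<noteq> 0" if "z \<in> D" for z
    using h[OF that] avoid(3)[OF that] by auto
  have y': "(y has_field_derivative 2 * z * Q z / (3 * (z\<^sup>2 - a)\<^sup>2)) (at z)" if "z \<in> D" for z
    unfolding y Q_def by (rule cubic_substitution_has_field_derivative[OF avoid(1)[OF that]])
  have y_hol: "y holomorphic_on D"
    using y' D(1) by (auto simp: holomorphic_on_open)
  have w: "sqrt_branch_on D (\<lambda>z. y z ^ 3 - 3 * a * y z + b) w"
    unfolding sqrt_branch_on_def
  proof
    have "continuous_on D s"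
      using s by (simp add: sqrt_branch_on_def)
    then show "continuous_on D w"
      unfolding w_def Q_def using avoid(1) c0 by (auto intro!: continuous_intros)
    show "\<forall>z\<in>D. (w z)\<^sup>2 = y z ^ 3 - 3 * a * y z + b"
    proof
      fix z assume z: "z \<in> D"
      have "(w z)\<^sup>2 = (s z)\<^sup>2 * (Q z)\<^sup>2 / (9 * c\<^sup>2 * (z\<^sup>2 - a) ^ 4)"
        by (simp add: w_def power_mult_distrib power_divide flip: power_mult)
      also have "\<dots> = (z\<^sup>2 - a) * ((8 * z ^ 3 - 6 * a * z - b) * (Q z)\<^sup>2) /
          ((z\<^sup>2 - a) * (27 * (z\<^sup>2 - a) ^ 3))"
        unfolding s2[OF z] c2 by (simp add: algebra_simps power4_eq_xxxx power3_eq_cube)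
      also have "\<dots> = y z ^ 3 - 3 * a * y z + b"
        unfolding h[OF z] using avoid(1)[OF z] by (rule nonzero_mult_divide_mult_cancel_left)
      finally show "(w z)\<^sup>2 = y z ^ 3 - 3 * a * y z + b" .
    qed
  qed
  have "s holomorphic_on D"
    by (rule sqrt_branch_on_holomorphic[OF D(1) s]) (use avoid in \<open>auto intro!: holomorphic_intros\<close>)
  then have "(\<lambda>z. (2 * z\<^sup>2 - a) / s z) holomorphic_on D"
    using s0 by (intro holomorphic_intros)
  then have exF: "\<exists>F. primitive_on D (\<lambda>z. (2 * z\<^sup>2 - a) / s z) F"
    by (rule primitive_on_exists[OF D])
  have exG: "\<exists>G. image_primitive_on D y (\<lambda>v. v) (\<lambda>v. v ^ 3 - 3 * a * v + b) w G"
    using D y_hol w avoid(3) by (intro image_primitive_on_exists) (auto intro!: holomorphic_intros)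
  have "\<exists>C. \<forall>z\<in>D. F z - 1 / 3 * (s z / (z\<^sup>2 - a)) = 1 / (2 * c) * G z + C"
    if F: "primitive_on D (\<lambda>z. (2 * z\<^sup>2 - a) / s z) F"
      and G: "image_primitive_on D y (\<lambda>v. v) (\<lambda>v. v ^ 3 - 3 * a * v + b) w G" for F G
  proof -
    let ?f = "\<lambda>z. z * (2 * z ^ 3 - b) / (3 * (z\<^sup>2 - a) * s z)"
    have lhs: "primitive_on D ?f (\<lambda>z. F z - 1 / 3 * (s z / (z\<^sup>2 - a)))"
      unfolding primitive_on_def
    proof
      fix z assume z: "z \<in> D"
      have "(F has_field_derivative (2 * z\<^sup>2 - a) / s z) (at z)"
        using F z by (simp add: primitive_on_def)
      from DERIV_diff[OF this algebraic_part_has_field_derivative[OF avoid(1,2)[OF z] D(1) z s]]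
      show "((\<lambda>z. F z - 1 / 3 * (s z / (z\<^sup>2 - a))) has_field_derivative ?f z) (at z)"
        by simp
    qed
    have rhs: "primitive_on D ?f (\<lambda>z. 1 / (2 * c) * G z)"
      unfolding primitive_on_def
    proof
      fix z assume z: "z \<in> D"
      define q where "q = z\<^sup>2 - a"
      define k where "k = Q z"
      have nz: "q \<noteq> 0" "k \<noteq> 0" "s z \<noteq> 0"
        using avoid(1) Q0 s0 z by (auto simp: q_def k_def)
      have "y z / w z * (2 * z * Q z / (3 * (z\<^sup>2 - a)\<^sup>2)) =
          (2 * z ^ 3 - b) / (3 * q) / (s z * k / (3 * c * q\<^sup>2)) * (2 * z * k / (3 * q\<^sup>2))"
        unfolding y w_def q_def k_def ..
      also have "\<dots> = 2 * c * (z * (2 * z ^ 3 - b) / (3 * q * s z))"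
        using nz c0 by (simp add: divide_simps)
      finally have "(G has_field_derivative 2 * c * ?f z) (at z)"
        using image_primitive_on_has_field_derivative[OF G z y'[OF z]] by (simp add: q_def)
      from DERIV_cmult[OF this, of "1 / (2 * c)"]
      show "((\<lambda>z. 1 / (2 * c) * G z) has_field_derivative ?f z) (at z)"
        using c0 by simp
    qed
    show ?thesis
      by (rule primitive_on_unique[OF D(1) simply_connected_imp_connected[OF D(2)] lhs rhs])
  qed
  then show ?thesis
    using w exF exG unfolding c_def by blast
qed

end
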